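(* Assume that there exist bounded open sets $\mathcal C_\theta$ and $\mathcal C_x$ whose closures are contained in $\Theta$ and $\mathbb{R}^n$ respectively, a positive integer $r$, a bounded subset $U_r$ of $\mathbb{R}^{r-1}$, and a real number $L_{\mathfrak H}>0$ such that for all $(x,\theta)$ and $(x^*,\theta^* )$ in $\mathrm{Cl}(\mathcal C_x)\times\mathrm{Cl}(\mathcal C_\theta)$ and all $v\in U_r$, $$\left|\mathfrak H_r(x^*,\theta^*,v)-\mathfrak H_r(x,\theta,v)\right|\ge L_{\mathfrak H}\left|\begin{bmatrix}x-x^*\\ \theta-\theta^*\end{bmatrix}\right| .$$ Let $u:[0,+\infty)\to\mathbb{R}$ be a $C^{r-1}$ function which is bounded together with its first $r-1$ derivatives, i.e. there is $\mathfrak u>0$ with $|(u(t),\dot u(t),\dots,u^{(r-1)}(t))|\le\mathfrak u$ for all $t\ge0$. Then for every $r$-tuple of distinct negative real numbers $(\tilde\lambda_1,\dots,\tilde\lambda_r)$, every $\tau>0$ and every $w_0\in\mathbb{R}^r$, there exist two positive real numbers $k^*$ and $\bar L_T$ such that for all $k>k^*$ the mapping $T$ associated with $\lambda_i=k\tilde\lambda_i$, $i=1,\dots,r$, is well defined on $\mathcal C_x\times\mathcal C_\theta\times\mathbb{R}^r$ and has the following property: for all $t_1\ge\tau$ such that $(u(t_1),\dot u(t_1),\dots,u^{(r-2)}(t_1))\in U_r$, and for all $(x,\theta)$ and $(x^*,\theta^* )$ in $\mathcal C_x\times\mathcal C_\theta$, $$\left|T(x,\theta,w(t_1))-T(x^*,\theta^*,w(t_1))\right|\ge\frac{\bar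 L_T}{k^r}\left|\begin{bmatrix}x-x^*\\ \theta-\theta^*\end{bmatrix}\right| ,$$ where $w(\cdot)$ is the solution of $\dot w_i=k\tilde\lambda_i w_i+u(t)$, $i=1,\dots,r$, with $w(0)=w_0$.
   Context: Consider the parameterized linear single-input single-output system $\dot x=A(\theta)x+B(\theta)u$, $y=C(\theta)x$, with $x\in\mathbb{R}^n$, $u,y\in\mathbb{R}$, $\theta\in\Theta\subset\mathbb{R}^q$, where $A:\Theta\to\mathbb{R}^{n\times n}$, $B:\Theta\to\mathbb{R}^{n\times1}$, $C:\Theta\to\mathbb{R}^{1\times n}$ are $C^1$ (a function is $C^1$ on $\Theta$ if it is the restriction of a $C^1$ function on an open neighbourhood of $\Theta$). $|\cdot|$ is the Euclidean norm and $\mathrm{Cl}$ denotes closure. For a positive integer $r$, $\theta\in\Theta$, $x\in\mathbb{R}^n$ and $v=(v_0,\dots,v_{r-2})\in\mathbb{R}^{r-1}$, define $$H_r(\theta)=\begin{bmatrix}C(\theta)\\ C(\theta)A(\theta)\\ \vdots\\ C(\theta)A(\theta)^{r-1}\end{bmatrix}\in\mathbb{R}^{r\times n},\qquad \mathfrak H_r(x,\theta,v)=H_r(\theta)x+\sum_{j=1}^{r-1}S^jH_r(\theta)B(\theta)v_{j-1}\in\mathbb{R}^r,$$ where $S:\mathbb{R}^r\to\mathbb{R}^r$ is the shift $S(s_1,\dots,s_r)=(0,s_1,\dots,s_{r-1})$. Given real numbers $\lambda_1,\dots,\lambda_r$, the associated mapping $T=(T_1,\dots,T_r)^\top$ is $$T_i(x,\theta,w)=M_i(\theta)\,[x-B(\theta)w_i],\qquad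 M_i(\theta)=C(\theta)\,(A(\theta)-\lambda_iI_n)^{-1},\qquad w=(w_1,\dots,w_r)\in\mathbb{R}^r,$$ defined for those $\theta$ such that no $\lambda_i$ is an eigenvalue of $A(\theta)$. *)

theory Defs
  imports "HOL-Analysis.Analysis"
begin

text \<open>
  Since \<open>r\<close> is a number, vectors of \<open>\<real>\<^sup>r\<close> are functions \<open>nat \<Rightarrow> real\<close> whose components are
  indexed by \<open>{..<r}\<close>, with Euclidean norm \<^term>\<open>\<lambda>s. L2_set s {..<r}\<close>.  All indices start
  at \<open>0\<close>.  A column \<open>B \<theta>\<close> and a row \<open>C \<theta>\<close> are both of type \<^typ>\<open>real ^ 'n\<close>, so that
  \<open>C \<theta> \<bullet> x\<close> is the product of a row and a column and \<open>C \<theta> v* A \<theta>\<close> that of a row and a matrix.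
\<close>

definition C1_on :: "'a::real_normed_vector set \<Rightarrow> ('a \<Rightarrow> 'b::real_normed_vector) \<Rightarrow> bool" where
  "C1_on S f \<longleftrightarrow>
     (\<exists>W g (g' :: 'a \<Rightarrow> 'a \<Rightarrow>\<^sub>L 'b). open W \<and> S \<subseteq> W \<and> (\<forall>x\<in>S. g x = f x) \<and>
        (\<forall>x\<in>W. (g has_derivative blinfun_apply (g' x)) (at x)) \<and> continuous_on W g')"

text \<open>
  Iterated derivatives of a function on \<open>[0, \<infinity>)\<close>, one-sided at \<open>0\<close>; for \<open>t \<ge> 0\<close> they do not
  depend on the values of the function at negative arguments.
\<close>

definition hderiv :: "nat \<Rightarrow> (real \<Rightarrow> real) \<Rightarrow> real \<Rightarrow> real" where
  "hderiv j u = ((\<lambda>f t. vector_derivative f (at t within {0..})) ^^ j) u"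

definition Ck_halfline :: "nat \<Rightarrow> (real \<Rightarrow> real) \<Rightarrow> bool" where
  "Ck_halfline m u \<longleftrightarrow>
     (\<forall>j<m. hderiv j u differentiable_on {0..}) \<and> (\<forall>j\<le>m. continuous_on {0..} (hderiv j u))"

text \<open>
  The overloaded power \<open>X ^ i\<close> on \<^typ>\<open>real ^ 'n ^ 'n\<close> would be componentwise.
\<close>

definition matpow :: "real ^ 'n ^ 'n \<Rightarrow> nat \<Rightarrow> real ^ 'n ^ 'n" where
  "matpow X i = (((**) X) ^^ i) (mat 1)"

definition eigval :: "real ^ 'n ^ 'n \<Rightarrow> real \<Rightarrow> bool" where
  "eigval X \<mu> \<longleftrightarrow> (\<exists>v. v \<noteq> 0 \<and> X *v v = \<mu> *\<^sub>R v)"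

text \<open>Row \<open>i\<close> of the matrix \<open>H\<^sub>r(\<theta>)\<close>; it does not depend on \<open>r > i\<close>.\<close>

definition Hrow :: "('t \<Rightarrow> real ^ 'n ^ 'n) \<Rightarrow> ('t \<Rightarrow> real ^ 'n) \<Rightarrow> 't \<Rightarrow> nat \<Rightarrow> real ^ 'n" where
  "Hrow A C \<theta> i = C \<theta> v* matpow (A \<theta>) i"

definition shift :: "nat \<Rightarrow> (nat \<Rightarrow> real) \<Rightarrow> nat \<Rightarrow> real" where
  "shift r s i = (if 0 < i \<and> i < r then s (i - 1) else 0)"

definition frakH ::
  "('t \<Rightarrow> real ^ 'n ^ 'n) \<Rightarrow> ('t \<Rightarrow> real ^ 'n) \<Rightarrow> ('t \<Rightarrow> real ^ 'n) \<Rightarrow> nat \<Rightarrow>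
    real ^ 'n \<Rightarrow> 't \<Rightarrow> (nat \<Rightarrow> real) \<Rightarrow> nat \<Rightarrow> real" where
  "frakH A B C r x \<theta> v i =
     Hrow A C \<theta> i \<bullet> x
     + (\<Sum>j=1..r-1. ((shift r ^^ j) (\<lambda>l. Hrow A C \<theta> l \<bullet> B \<theta>)) i * v (j - 1))"

definition M :: "('t \<Rightarrow> real ^ 'n ^ 'n) \<Rightarrow> ('t \<Rightarrow> real ^ 'n) \<Rightarrow> real \<Rightarrow> 't \<Rightarrow> real ^ 'n" where
  "M A C \<mu> \<theta> = C \<theta> v* matrix_inv (A \<theta> - \<mu> *\<^sub>R mat 1)"

text \<open>\<open>l\<close> is the tuple of the \<open>\<lambda>\<^sub>i\<close>.\<close>

definition T ::
  "('t \<Rightarrow> real ^ 'n ^ 'n) \<Rightarrow> ('t \<Rightarrow> real ^ 'n) \<Rightarrow> ('t \<Rightarrow> real ^ 'n) \<Rightarrow> (nat \<Rightarrow> real) \<Rightarrow>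
    real ^ 'n \<Rightarrow> 't \<Rightarrow> (nat \<Rightarrow> real) \<Rightarrow> nat \<Rightarrow> real" where
  "T A B C l x \<theta> w i = M A C (l i) \<theta> \<bullet> (x - w i *\<^sub>R B \<theta>)"

text \<open>
  \<^const>\<open>matrix_inv\<close> is total, so the domain of \<^const>\<open>T\<close> has to be stated separately;
  it restricts neither \<open>x\<close> nor \<open>w\<close>.
\<close>

definition T_defined_at ::
  "('t \<Rightarrow> real ^ 'n ^ 'n) \<Rightarrow> nat \<Rightarrow> (nat \<Rightarrow> real) \<Rightarrow> 't \<Rightarrow> bool" where
  "T_defined_at A r l \<theta> \<longleftrightarrow> (\<forall>i<r. \<not> eigval (A \<theta>) (l i))"

definition filter_solution ::
  "nat \<Rightarrow> (nat \<Rightarrow> real) \<Rightarrow> (real \<Rightarrow> real) \<Rightarrow> (nat \<Rightarrow> real) \<Rightarrow> (real \<Rightarrow> nat \<Rightarrow> real) \<Rightarrow> bool" where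
  "filter_solution r l u w0 w \<longleftrightarrow>
     (\<forall>i<r. w 0 i = w0 i \<and>
        (\<forall>t\<ge>0. ((\<lambda>s. w s i) has_real_derivative (l i * w t i + u t)) (at t within {0..})))"

end

theory Submission
  imports Defs
begin

text \<open>
  Let \<open>\<xi>\<^sub>0 = x\<close>, \<open>\<xi>\<^sub>j\<^sub>+\<^sub>1 = A \<xi>\<^sub>j + v\<^sub>j B\<close>, so that \<open>C \<xi>\<^sub>j\<close> is the \<open>j\<close>-th component of \<^const>\<open>frakH\<close>, and let
  \<open>N = (A - \<mu>)\<inverse>\<close> with \<open>\<mu> = k l\<^sub>i\<close>.  Iterating \<open>N \<xi>\<^sub>j = (N \<xi>\<^sub>j\<^sub>+\<^sub>1 - v\<^sub>j N B - \<xi>\<^sub>j) / \<mu>\<close> gives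
  \<open>T\<^sub>i = - (\<Sum>j<r. C \<xi>\<^sub>j / \<mu> ^ (j+1)) + C N A \<xi>\<^sub>r\<^sub>-\<^sub>1 / \<mu> ^ r - R\<^sub>i (C N B)\<close>, where
  \<open>R\<^sub>i = w\<^sub>i + (\<Sum>j<r-1. u\<^sup>(\<^sup>j\<^sup>) / \<mu> ^ (j+1))\<close> solves \<open>R\<^sub>i' = \<mu> R\<^sub>i + u\<^sup>(\<^sup>r\<^sup>-\<^sup>1\<^sup>) / \<mu> ^ (r-1)\<close> and is hence \<open>O(1/k ^ r)\<close> for
  \<open>t \<ge> \<tau>\<close>.  Since \<open>N\<close> is \<open>O(1/k)\<close> together with its Lipschitz constant, all terms but the first sum
  have Lipschitz constant \<open>O(1/k ^ (r+1))\<close> in \<open>(x, \<theta>)\<close>.  The first sum is a Vandermonde matrix in the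
  \<open>1/l\<^sub>i\<close> applied to \<open>C \<xi>\<^sub>j / k ^ (j+1)\<close>, so it inherits a lower bound of order \<open>1/k ^ r\<close> from \<^const>\<open>frakH\<close>.
\<close>

section \<open>Bounded Lipschitz functions\<close>

text \<open>One constant serves both as sup bound and as Lipschitz constant, so that sums, products
  and resolvents each cost a single estimate. \<open>K\<close> may be negative when \<open>S\<close>
  is empty, which is why sign conditions appear separately.\<close>

definition blip :: "real \<Rightarrow> 'a::real_normed_vector set \<Rightarrow> ('a \<Rightarrow> 'b::real_normed_vector) \<Rightarrow> bool" where
  "blip K S f \<longleftrightarrow>
     (\<forall>p\<in>S. norm (f p) \<le> K) \<and> (\<forall>p\<in>S. \<forall>q\<in>S. norm (f p - f q) \<le> K * norm (p - q))"

lemma blip_mono: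
  assumes "blip K S f" and "K \<le> L"
  shows "blip L S f"
  using assms unfolding blip_def
  by (meson mult_right_mono norm_ge_zero order_trans)

lemma blip_subset: "blip K S f \<Longrightarrow> R \<subseteq> S \<Longrightarrow> blip K R f"
  unfolding blip_def by blast

lemma blip_add:
  assumes "blip K S f" and "blip L S g"
  shows "blip (K + L) S (\<lambda>p. f p + g p)"
  unfolding blip_def
proof (intro conjI ballI)
  fix p assume p: "p \<in> S"
  show "norm (f p + g p) \<le> K + L"
    using assms p unfolding blip_def by (intro norm_triangle_mono) auto
  fix q assume q: "q \<in> S"
  have "norm (f p + g p - (f q + g q)) \<le> norm (f p - f q) + norm (g p - g q)"
    by (rule norm_diff_triangle_ineq)
  also have "\<dots> \<le> K * norm (p - q) + L * norm (p - q)"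
    using assms p q unfolding blip_def by (intro add_mono) auto
  finally show "norm (f p + g p - (f q + g q)) \<le> (K + L) * norm (p - q)"
    by (simp add: algebra_simps)
qed

lemma blip_scaleR:
  assumes "blip K S f"
  shows "blip (\<bar>c\<bar> * K) S (\<lambda>p. c *\<^sub>R f p)"
  using assms unfolding blip_def
  by (auto simp: mult_left_mono mult.assoc simp flip: scaleR_diff_right)

text \<open>The difference of products splits into a variation of \<open>f\<close> and a variation
  of \<open>g\<close>; each costs \<open>K * L\<close>, whence the factor 2.\<close>

lemma blip_bilinear:
  assumes h: "bounded_bilinear h" and hle: "\<And>a b. norm (h a b) \<le> norm a * norm b"
    and f: "blip K S f" and g: "blip L S g" and K: "0 \<le> K"
  shows "blip (2 * K * L) S (\<lambda>p. h (f p) (g p))"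
  unfolding blip_def
proof (intro conjI ballI)
  interpret bounded_bilinear h by (rule h)
  fix p assume p: "p \<in> S"
  have fp: "norm (f p) \<le> K" and gp: "norm (g p) \<le> L" using f g p unfolding blip_def by auto
  have L: "0 \<le> L" using gp norm_ge_zero order_trans by blast
  have "norm (h (f p) (g p)) \<le> K * L"
    using hle[of "f p" "g p"] mult_mono[OF fp gp] K by (meson norm_ge_zero order_trans)
  moreover have "0 \<le> K * L" using K L by simp
  ultimately show "norm (h (f p) (g p)) \<le> 2 * K * L" by linarith
  fix q assume q: "q \<in> S"
  have fq: "norm (f q) \<le> K" using f q unfolding blip_def by auto
  have fd: "norm (f p - f q) \<le> K * norm (p - q)" and gd: "norm (g p - g q) \<le> L * norm (p - q)"
    using f g p q unfolding blip_def by auto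
  have "h (f p) (g p) - h (f q) (g q) = h (f p - f q) (g p) + h (f q) (g p - g q)"
    by (simp add: diff_left diff_right)
  also have "norm \<dots> \<le> norm (f p - f q) * norm (g p) + norm (f q) * norm (g p - g q)"
    by (rule norm_triangle_mono; rule hle)
  also have "\<dots> \<le> (K * norm (p - q)) * L + K * (L * norm (p - q))"
    using fd gd fq gp K L by (intro add_mono mult_mono) auto
  finally show "norm (h (f p) (g p) - h (f q) (g q)) \<le> 2 * K * L * norm (p - q)"
    by (simp add: algebra_simps)
qed

text \<open>Without convexity of \<open>K\<close> the mean value inequality works only on small
  balls, where continuity of the derivative keeps its norm below \<open>norm (g' x) + 1\<close>.
  Compactness turns the local Lipschitz property into a global one.\<close>

lemma C1_on_imp_lipschitz_on_compact:
  fixes f :: "'a::real_normed_vector \<Rightarrow> 'b::real_normed_vector"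
  assumes "C1_on S f" and K: "compact K" and KS: "K \<subseteq> S"
  obtains L where "L-lipschitz_on K f"
proof -
  obtain W g and g' :: "'a \<Rightarrow> 'a \<Rightarrow>\<^sub>L 'b" where W: "open W" "S \<subseteq> W" and gf: "\<forall>x\<in>S. g x = f x"
    and der: "\<forall>x\<in>W. (g has_derivative blinfun_apply (g' x)) (at x)"
    and cont: "continuous_on W g'"
    using assms(1) unfolding C1_on_def by blast
  \<comment> \<open>\<open>local_lipschitz\<close> speaks of families with a time parameter; time is
    the dummy singleton \<open>{0}\<close> here.\<close>
  have "local_lipschitz {0::real} K (\<lambda>_. g)"
  proof (rule local_lipschitzI)
    fix t :: real and x assume x: "x \<in> K"
    then have xW: "x \<in> W" using KS W by auto
    have "isCont g' x" using cont W(1) xW by (simp add: continuous_on_eq_continuous_at)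
    then have "\<forall>\<^sub>F y in nhds x. dist (g' y) (g' x) < 1"
      using tendstoD[of g' "g' x" "nhds x" 1] continuous_at_imp_continuous_within
      by (simp add: continuous_at tendsto_at_iff_tendsto_nhds)
    moreover have "\<forall>\<^sub>F y in nhds x. y \<in> W" using W(1) xW by (rule eventually_nhds_in_open)
    ultimately have "\<forall>\<^sub>F y in nhds x. dist (g' y) (g' x) < 1 \<and> y \<in> W"
      by (rule eventually_conj)
    then obtain d where d: "d > 0" and dd: "\<And>y. dist y x < d \<Longrightarrow> dist (g' y) (g' x) < 1 \<and> y \<in> W"
      unfolding eventually_nhds_metric by blast
    define B where "B = norm (g' x) + 1"
    have "B-lipschitz_on (cball x (d/2)) g"
    proof (rule bounded_derivative_imp_lipschitz)
      fix y assume "y \<in> cball x (d/2)"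
      then have y: "dist y x < d" using d by (auto simp: dist_commute)
      show "(g has_derivative blinfun_apply (g' y)) (at y within cball x (d/2))"
        using dd[OF y] der has_derivative_at_withinI by blast
      have "norm (g' y) \<le> norm (g' x) + norm (g' y - g' x)"
        by (rule norm_triangle_sub)
      then have "norm (g' y) \<le> B" using dd[OF y] by (simp add: B_def dist_norm)
      then show "onorm (blinfun_apply (g' y)) \<le> B" by (simp add: norm_blinfun.rep_eq)
    qed (auto simp: B_def)
    then have "B-lipschitz_on (cball x (d/2) \<inter> K) g" by (rule lipschitz_on_subset) auto
    then show "\<exists>u>0. \<exists>L. \<forall>t\<in>cball t u \<inter> {0}. L-lipschitz_on (cball x u \<inter> K) g"
      using d by (intro exI[of _ "d/2"]) auto
  qed
  then obtain L where "L-lipschitz_on K g"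
    by (rule local_lipschitz_compact_implies_lipschitz[OF _ K]) auto
  moreover have "g x = f x" if "x \<in> K" for x using KS gf that by blast
  ultimately have "L-lipschitz_on K f" by (simp add: lipschitz_on_def)
  then show thesis by (rule that)
qed

text \<open>Later estimates are in the pair \<open>(x, \<theta>)\<close>; a function of \<theta>
  alone is Lipschitz in the pair because \<open>snd\<close> does not increase norms.\<close>

lemma C1_on_imp_blip:
  fixes f :: "'a::{real_normed_vector,heine_borel} \<Rightarrow> 'b::real_normed_vector"
    and X :: "'c::real_normed_vector set"
  assumes "C1_on \<Theta> f" and "bounded S" and "closure S \<subseteq> \<Theta>"
  obtains K where "0 \<le> K" and "blip K (X \<times> S) (\<lambda>p. f (snd p))"
proof -
  have comp: "compact (closure S)" using assms(2) by (simp add: compact_closure)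
  obtain L where L: "L-lipschitz_on (closure S) f"
    using C1_on_imp_lipschitz_on_compact[OF assms(1) comp assms(3)] by blast
  have "bounded (f ` closure S)"
    using comp lipschitz_on_continuous_on[OF L] compact_continuous_image compact_imp_bounded by blast
  then obtain b where b: "\<And>x. x \<in> closure S \<Longrightarrow> norm (f x) \<le> b"
    unfolding bounded_iff by blast
  define K where "K = max L (max b 0)"
  have "norm (f x - f y) \<le> K * norm (p - q)" if "x = snd p" "y = snd q" "p \<in> X \<times> S" "q \<in> X \<times> S" for p q x y
  proof -
    have "x \<in> closure S" "y \<in> closure S" using that subsetD[OF closure_subset] by auto
    then have "norm (f x - f y) \<le> L * norm (x - y)" using lipschitz_onD[OF L, of x y] by (simp add: dist_norm)
    also have "\<dots> \<le> K * norm (p - q)"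
    proof (rule mult_mono)
      have "norm (snd (p - q)) \<le> norm (p - q)"
        using norm_snd_le[of "snd (p - q)" "fst (p - q)"] unfolding prod.collapse .
      then show "norm (x - y) \<le> norm (p - q)" using that by simp
    qed (auto simp: K_def)
    finally show ?thesis .
  qed
  moreover have "norm (f (snd p)) \<le> K" if "p \<in> X \<times> S" for p
    using b[of "snd p"] that closure_subset by (force simp: K_def)
  ultimately have "blip K (X \<times> S) (\<lambda>p. f (snd p))" by (auto simp: blip_def)
  then show thesis by (intro that[of K]) (auto simp: K_def)
qed

section \<open>The resolvent\<close>

lemma norm_matrix_vector_mult_le: "norm (X *v y) \<le> norm X * norm y" for X :: "real ^ 'n ^ 'm"
proof -
  have "norm (X *v y) \<le> L2_set (\<lambda>i. norm (X $ i) * norm y) UNIV"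
    unfolding norm_vec_def[of "X *v y"]
    by (rule L2_set_mono) (auto simp: matrix_vector_mul_component Cauchy_Schwarz_ineq2)
  then show ?thesis by (simp add: norm_vec_def[of X] L2_set_left_distrib)
qed

lemma bounded_bilinear_matrix_vector_mult:
  "bounded_bilinear ((*v) :: real ^ 'n ^ 'm \<Rightarrow> real ^ 'n \<Rightarrow> real ^ 'm)"
proof unfold_locales
  show "\<exists>K. \<forall>(X :: real ^ 'n ^ 'm) y. norm (X *v y) \<le> norm X * norm y * K"
    using norm_matrix_vector_mult_le by (intro exI[of _ 1]) auto
qed (auto simp: algebra_simps matrix_vector_mult_scaleR scaleR_matrix_vector_assoc)

text \<open>Triangle inequality for \<open>\<mu> y = X y - (X - \<mu>) y\<close>, where
  \<open>X y\<close> is absorbed into half of the left side. This gives both injectivity of the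
  shifted matrix and the bound \<open>2 / \<bar>\<mu>\<bar>\<close> for its inverse.\<close>

lemma norm_le_shifted_matrix:
  fixes X :: "real ^ 'n ^ 'n"
  assumes "2 * norm X \<le> \<bar>\<mu>\<bar>"
  shows "\<bar>\<mu>\<bar> * norm y \<le> 2 * norm ((X - \<mu> *\<^sub>R mat 1) *v y)"
proof -
  have "\<bar>\<mu>\<bar> * norm y = norm (X *v y - (X - \<mu> *\<^sub>R mat 1) *v y)"
    by (simp add: matrix_vector_mult_diff_rdistrib flip: scaleR_matrix_vector_assoc)
  also have "\<dots> \<le> norm (X *v y) + norm ((X - \<mu> *\<^sub>R mat 1) *v y)" by (rule norm_triangle_ineq4)
  also have "norm (X *v y) \<le> norm X * norm y" by (rule norm_matrix_vector_mult_le)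
  also have "norm X * norm y \<le> \<bar>\<mu>\<bar> / 2 * norm y" using assms by (intro mult_right_mono) auto
  finally show ?thesis by simp
qed

lemma invertible_shifted_matrix:
  fixes X :: "real ^ 'n ^ 'n"
  assumes "2 * norm X \<le> \<bar>\<mu>\<bar>" and "\<mu> \<noteq> 0"
  shows "invertible (X - \<mu> *\<^sub>R mat 1)"
proof -
  have "y = 0" if "(X - \<mu> *\<^sub>R mat 1) *v y = 0" for y
    using norm_le_shifted_matrix[OF assms(1), of y] that assms(2) by (simp add: mult_le_0_iff)
  then show ?thesis
    by (metis invertible_left_inverse matrix_left_invertible_ker)
qed

lemma not_eigval_of_large:
  fixes X :: "real ^ 'n ^ 'n"
  assumes "2 * norm X \<le> \<bar>\<mu>\<bar>" and "\<mu> \<noteq> 0"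
  shows "\<not> eigval X \<mu>"
proof
  assume "eigval X \<mu>"
  then obtain v where v: "v \<noteq> 0" "X *v v = \<mu> *\<^sub>R v" unfolding eigval_def by blast
  then have "(X - \<mu> *\<^sub>R mat 1) *v v = 0"
    by (simp add: matrix_vector_mult_diff_rdistrib flip: scaleR_matrix_vector_assoc)
  then show False
    using norm_le_shifted_matrix[OF assms(1), of v] v assms(2) by (simp add: mult_le_0_iff)
qed

lemma matrix_inv_mult_vec:
  fixes X :: "real ^ 'n ^ 'n"
  assumes "invertible X"
  shows "X *v (matrix_inv X *v y) = y" and "matrix_inv X *v (X *v y) = y"
proof -
  have "X ** matrix_inv X = mat 1 \<and> matrix_inv X ** X = mat 1"
    using assms unfolding invertible_def matrix_inv_def by (rule someI_ex)
  then show "X *v (matrix_inv X *v y) = y" and "matrix_inv X *v (X *v y) = y"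
    by (simp_all add: matrix_vector_mul_assoc)
qed

text \<open>Subtracting the equations for \<open>y p\<close> and \<open>y q\<close> expresses
  \<open>(X p - \<mu>) (y p - y q)\<close> by the variations of \<open>g\<close> and
  \<open>X\<close>, and the lower bound for the shifted matrix applies. As
  \<open>a \<le> \<bar>\<mu>\<bar> / 2\<close> and
  \<open>norm (y q) \<le> 2 * K / \<bar>\<mu>\<bar>\<close>, each variation contributes
  \<open>K\<close>; the factor 2 of the lower bound makes this \<open>4 * K\<close>.\<close>

lemma blip_resolvent:
  fixes X :: "'p::real_normed_vector \<Rightarrow> real ^ 'n ^ 'n"
  assumes X: "blip a S X" and g: "blip K S g" and K: "0 \<le> K"
    and \<mu>: "2 * a \<le> \<bar>\<mu>\<bar>" "\<mu> \<noteq> 0"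
  shows "blip (4 * K / \<bar>\<mu>\<bar>) S (\<lambda>p. matrix_inv (X p - \<mu> *\<^sub>R mat 1) *v g p)"
  unfolding blip_def
proof (intro conjI ballI)
  define y where "y p = matrix_inv (X p - \<mu> *\<^sub>R mat 1) *v g p" for p
  have le: "2 * norm (X p) \<le> \<bar>\<mu>\<bar>" if "p \<in> S" for p
    using X \<mu>(1) that unfolding blip_def by force
  have eq: "(X p - \<mu> *\<^sub>R mat 1) *v y p = g p" if "p \<in> S" for p
    unfolding y_def using matrix_inv_mult_vec(1) invertible_shifted_matrix[OF le[OF that] \<mu>(2)] by blast
  have ny: "\<bar>\<mu>\<bar> * norm (y p) \<le> 2 * K" if "p \<in> S" for p
  proof -
    have "\<bar>\<mu>\<bar> * norm (y p) \<le> 2 * norm (g p)"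
      using norm_le_shifted_matrix[OF le[OF that], of "y p"] eq[OF that] by simp
    then show ?thesis using g that unfolding blip_def by force
  qed
  fix p assume p: "p \<in> S"
  show "norm (y p) \<le> 4 * K / \<bar>\<mu>\<bar>"
    using ny[OF p] K \<mu>(2) by (simp add: pos_le_divide_eq mult.commute)
  fix q assume q: "q \<in> S"
  have "(X p - \<mu> *\<^sub>R mat 1) *v (y p - y q) = (g p - g q) - (X p - X q) *v y q"
    using eq[OF p] eq[OF q] by (simp add: algebra_simps)
  then have "\<bar>\<mu>\<bar> * norm (y p - y q) \<le> 2 * norm ((g p - g q) - (X p - X q) *v y q)"
    using norm_le_shifted_matrix[OF le[OF p], of "y p - y q"] by simp
  also have "\<dots> \<le> 2 * (norm (g p - g q) + norm (X p - X q) * norm (y q))"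
    using norm_triangle_ineq4[of "g p - g q" "(X p - X q) *v y q"]
      norm_matrix_vector_mult_le[of "X p - X q" "y q"] by (simp add: algebra_simps)
  also have "norm (X p - X q) * norm (y q) \<le> (a * norm (p - q)) * norm (y q)"
    using X p q unfolding blip_def by (intro mult_right_mono) auto
  also have "\<dots> \<le> (\<bar>\<mu>\<bar> / 2 * norm (p - q)) * norm (y q)"
    using \<mu>(1) by (intro mult_right_mono) auto
  also have "\<dots> = norm (p - q) * (\<bar>\<mu>\<bar> * norm (y q)) / 2" by simp
  also have "\<dots> \<le> norm (p - q) * (2 * K) / 2"
    using ny[OF q] by (intro divide_right_mono mult_left_mono) auto
  also have "norm (g p - g q) \<le> K * norm (p - q)" using g p q unfolding blip_def by auto
  finally have "\<bar>\<mu>\<bar> * norm (y p - y q) \<le> 4 * K * norm (p - q)" by (simp add: algebra_simps)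
  then show "norm (y p - y q) \<le> 4 * K / \<bar>\<mu>\<bar> * norm (p - q)"
    using \<mu>(2) by (simp add: field_simps)
qed

section \<open>Vandermonde systems\<close>

text \<open>Lagrange interpolation: the inner sum is the polynomial with coefficients
  \<open>z\<close> at the node \<open>\<mu> i\<close>, and \<open>W j i\<close> is the j-th
  coefficient of the Lagrange basis polynomial of that node.\<close>

lemma vandermonde_left_inverse:
  fixes \<mu> :: "nat \<Rightarrow> 'a::field"
  assumes inj: "inj_on \<mu> {..<r}"
  obtains W where "\<And>z j. j < r \<Longrightarrow> z j = (\<Sum>i<r. W j i * (\<Sum>m<r. z m * \<mu> i ^ m))"
proof -
  define L where "L i = smult (inverse (\<Prod>m\<in>{..<r}-{i}. \<mu> i - \<mu> m)) (\<Prod>m\<in>{..<r}-{i}. [:- \<mu> m, 1:])" for i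
  have degL: "degree (L i) < r" if "i < r" for i
  proof -
    have "degree (L i) \<le> degree (\<Prod>m\<in>{..<r}-{i}. [:- \<mu> m, 1:])" unfolding L_def by (rule degree_smult_le)
    also have "\<dots> \<le> sum (degree \<circ> (\<lambda>m. [:- \<mu> m, 1:])) ({..<r}-{i})" by (rule degree_prod_sum_le) simp
    also have "\<dots> = card ({..<r}-{i})" by simp
    also have "\<dots> < r" using that by simp
    finally show ?thesis .
  qed
  have L: "poly (L i) (\<mu> i') = (if i = i' then 1 else 0)" if "i < r" "i' < r" for i i'
  proof (cases "i = i'")
    case True
    have "(\<Prod>m\<in>{..<r}-{i}. \<mu> i - \<mu> m) \<noteq> 0"
      using inj that by (auto simp: inj_on_def)
    then show ?thesis using True by (simp add: L_def poly_prod)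
  next
    case False
    then show ?thesis using that by (auto simp: L_def poly_prod)
  qed
  have "z j = (\<Sum>i<r. coeff (L i) j * (\<Sum>m<r. z m * \<mu> i ^ m))" if j: "j < r" for z j
  proof -
    define P where "P = (\<Sum>m<r. monom (z m) m)"
    \<comment> \<open>Both sides have degree at most \<open>r - 1\<close> and agree at
      \<open>r\<close> distinct nodes; \<open>j < r\<close> ensures that \<open>r\<close> is
      positive, so that \<open>r - 1 < r\<close>.\<close>
    have "P = (\<Sum>i<r. smult (poly P (\<mu> i)) (L i))" (is "_ = ?Q")
    proof (rule poly_eqI_degree[where A = "\<mu> ` {..<r}"])
      fix x assume "x \<in> \<mu> ` {..<r}"
      then obtain i' where "i' < r" "x = \<mu> i'" by auto
      then show "poly P x = poly ?Q x" by (simp add: poly_sum L if_distrib cong: if_cong)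
    next
      have c: "card (\<mu> ` {..<r}) = r" using inj by (simp add: card_image)
      have "degree P \<le> r - 1" unfolding P_def
        by (rule degree_sum_le) (auto intro: order_trans[OF degree_monom_le])
      then show "degree P < card (\<mu> ` {..<r})" using j c by linarith
      have "degree ?Q \<le> r - 1"
      proof (rule degree_sum_le)
        fix i assume "i \<in> {..<r}"
        then have "degree (L i) \<le> r - 1" using degL[of i] by simp
        then show "degree (smult (poly P (\<mu> i)) (L i)) \<le> r - 1"
          using degree_smult_le order_trans by blast
      qed simp
      then show "degree ?Q < card (\<mu> ` {..<r})" using j c by linarith
    qed
    then have "coeff P j = coeff ?Q j" by (rule arg_cong)
    moreover have "coeff P j = z j" using j by (simp add: P_def coeff_sum)
    ultimately show ?thesis
      by (simp add: coeff_sum P_def poly_sum poly_monom mult.commute)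
  qed
  then show thesis by (rule that)
qed

text \<open>Factoring out \<open>1 / l i\<close> leaves a Vandermonde system with nodes
  \<open>1 / l i\<close>; the constant is the reciprocal of a bound on its left inverse.\<close>

lemma L2_set_vandermonde_ge:
  fixes l :: "nat \<Rightarrow> real"
  assumes inj: "inj_on l {..<r}" and nz: "\<And>i. i < r \<Longrightarrow> l i \<noteq> 0"
  obtains c where "c > 0"
    and "\<And>z. c * L2_set z {..<r} \<le> L2_set (\<lambda>i. \<Sum>j<r. z j / l i ^ Suc j) {..<r}"
proof -
  have "inj_on (\<lambda>i. inverse (l i)) {..<r}" using inj by (auto simp: inj_on_def)
  then obtain W where W: "\<And>z j. j < r \<Longrightarrow> z j = (\<Sum>i<r. W j i * (\<Sum>m<r. z m * inverse (l i) ^ m))"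
    using vandermonde_left_inverse by blast
  \<comment> \<open>The summand 1 keeps \<open>c\<close> positive even if the double sum
    vanishes.\<close>
  define c where "c = 1 + (\<Sum>j<r. \<Sum>i<r. \<bar>W j i * l i\<bar>)"
  have c: "c > 0" unfolding c_def by (intro add_pos_nonneg sum_nonneg) auto
  have "L2_set z {..<r} \<le> c * L2_set (\<lambda>i. \<Sum>j<r. z j / l i ^ Suc j) {..<r}" for z
  proof -
    define y where "y i = (\<Sum>j<r. z j / l i ^ Suc j)" for i
    have y: "l i * y i = (\<Sum>m<r. z m * inverse (l i) ^ m)" if "i < r" for i
      using nz[OF that] unfolding y_def
      by (auto simp: sum_distrib_left field_simps intro!: sum.cong)
    have z: "z j = (\<Sum>i<r. W j i * l i * y i)" if "j < r" for j
      using W[OF that, of z] y by (simp add: mult.assoc)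
    have "L2_set z {..<r} \<le> (\<Sum>j<r. \<bar>z j\<bar>)" by (rule L2_set_le_sum_abs)
    also have "\<dots> \<le> (\<Sum>j<r. \<Sum>i<r. \<bar>W j i * l i\<bar> * L2_set y {..<r})"
    proof (rule sum_mono)
      fix j assume j: "j \<in> {..<r}"
      have yL: "\<bar>y i\<bar> \<le> L2_set y {..<r}" if "i < r" for i
        using member_le_L2_set[of "{..<r}" i "\<lambda>i. \<bar>y i\<bar>"] that by (simp add: L2_set_def)
      have "\<bar>z j\<bar> \<le> (\<Sum>i<r. \<bar>W j i * l i * y i\<bar>)" using z[of j] j sum_abs by simp
      also have "\<dots> \<le> (\<Sum>i<r. \<bar>W j i * l i\<bar> * L2_set y {..<r})"
        using yL by (intro sum_mono) (auto simp: abs_mult intro!: mult_left_mono)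
      finally show "\<bar>z j\<bar> \<le> (\<Sum>i<r. \<bar>W j i * l i\<bar> * L2_set y {..<r})" .
    qed
    also have "\<dots> = (c - 1) * L2_set y {..<r}"
      by (simp add: c_def sum_distrib_right)
    also have "\<dots> \<le> c * L2_set y {..<r}" by (intro mult_right_mono) auto
    finally show ?thesis unfolding y_def .
  qed
  then have "inverse c * L2_set z {..<r} \<le> L2_set (\<lambda>i. \<Sum>j<r. z j / l i ^ Suc j) {..<r}" for z
    using c by (simp add: field_simps)
  with c show thesis by (intro that[of "inverse c"]) auto
qed

section \<open>The filter\<close>

lemma hderiv_has_real_derivative:
  assumes "Ck_halfline m u" and "j < m" and "t \<ge> 0"
  shows "(hderiv j u has_real_derivative hderiv (Suc j) u t) (at t within {0..})"
proof -
  have "hderiv j u differentiable (at t within {0..})"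
    using assms by (auto simp: Ck_halfline_def differentiable_on_def)
  then have "(hderiv j u has_vector_derivative hderiv (Suc j) u t) (at t within {0..})"
    by (simp add: vector_derivative_works hderiv_def)
  then show ?thesis by (simp add: has_real_derivative_iff_has_vector_derivative)
qed

text \<open>Gronwall argument: \<open>exp (- (\<mu> * s)) * \<psi> s\<close> is
  nonincreasing.\<close>

lemma exp_comparison:
  fixes \<psi> \<psi>' :: "real \<Rightarrow> real"
  assumes der: "\<And>s. s \<ge> 0 \<Longrightarrow> (\<psi> has_real_derivative \<psi>' s) (at s within {0..})"
    and le: "\<And>s. s \<ge> 0 \<Longrightarrow> \<psi>' s \<le> \<mu> * \<psi> s" and t: "t \<ge> 0"
  shows "\<psi> t \<le> exp (\<mu> * t) * \<psi> 0"
proof -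
  define \<phi> where "\<phi> s = exp (- (\<mu> * s)) * \<psi> s" for s
  have d: "(\<phi> has_real_derivative exp (- (\<mu> * s)) * (\<psi>' s - \<mu> * \<psi> s)) (at s within {0..})" if "s \<ge> 0" for s
    unfolding \<phi>_def using der[OF that]
    by (auto intro!: derivative_eq_intros simp: algebra_simps)
  have "\<phi> t \<le> \<phi> 0"
  \<comment> \<open>At the endpoint 0 continuity suffices; at interior points the derivative within
    \<open>{0..}\<close> is the ordinary one.\<close>
  proof (rule DERIV_nonpos_imp_decreasing_open[OF t])
    fix s assume s: "0 < s" "s < t"
    then have "at s within {0..} = at s" by (intro at_within_interior) simp
    then have "(\<phi> has_real_derivative exp (- (\<mu> * s)) * (\<psi>' s - \<mu> * \<psi> s)) (at s)"
      using d[of s] s by simp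
    moreover have "exp (- (\<mu> * s)) * (\<psi>' s - \<mu> * \<psi> s) \<le> 0"
      using le[of s] s by (simp add: mult_le_0_iff)
    ultimately show "\<exists>y. DERIV \<phi> s :> y \<and> y \<le> 0" by blast
  next
    have "continuous_on {0..} \<phi>" using d by (intro DERIV_continuous_on) auto
    then show "continuous_on {0..t} \<phi>" by (rule continuous_on_subset) auto
  qed
  then show ?thesis by (simp add: \<phi>_def exp_minus field_simps)
qed

text \<open>The comparison is applied to \<open>R - b\<close> and \<open>- R - b\<close>. The shift
  \<open>b = D / \<bar>\<mu>\<bar>\<close> is the equilibrium under constant forcing
  \<open>D\<close> and thus absorbs \<open>d\<close>.\<close>

lemma abs_exp_comparison:
  fixes R d :: "real \<Rightarrow> real"
  assumes der: "\<And>s. s \<ge> 0 \<Longrightarrow> (R has_real_derivative \<mu> * R s + d s) (at s within {0..})"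
    and d: "\<And>s. s \<ge> 0 \<Longrightarrow> \<bar>d s\<bar> \<le> D" and \<mu>: "\<mu> < 0" and t: "t \<ge> 0"
  shows "\<bar>R t\<bar> \<le> exp (\<mu> * t) * \<bar>R 0\<bar> + D / \<bar>\<mu>\<bar>"
proof -
  define b where "b = D / \<bar>\<mu>\<bar>"
  have b: "\<mu> * b = - D" using \<mu> by (simp add: b_def)
  have "0 \<le> D" using d[of 0] by auto
  then have bn: "0 \<le> exp (\<mu> * t) * b" by (simp add: b_def)
  have "R t - b \<le> exp (\<mu> * t) * (R 0 - b)"
  proof (rule exp_comparison[OF _ _ t, where \<psi>' = "\<lambda>s. \<mu> * R s + d s"])
    fix s :: real assume s: "s \<ge> 0"
    show "((\<lambda>s. R s - b) has_real_derivative \<mu> * R s + d s) (at s within {0..})"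
      using der[OF s] by (auto intro!: derivative_eq_intros)
    show "\<mu> * R s + d s \<le> \<mu> * (R s - b)" using d[OF s] b by (simp add: algebra_simps)
  qed
  moreover have "- R t - b \<le> exp (\<mu> * t) * (- R 0 - b)"
  proof (rule exp_comparison[OF _ _ t, where \<psi>' = "\<lambda>s. - (\<mu> * R s + d s)"])
    fix s :: real assume s: "s \<ge> 0"
    show "((\<lambda>s. - R s - b) has_real_derivative - (\<mu> * R s + d s)) (at s within {0..})"
      using der[OF s] by (auto intro!: derivative_eq_intros)
    show "- (\<mu> * R s + d s) \<le> \<mu> * (- R s - b)" using d[OF s] b by (simp add: algebra_simps)
  qed
  moreover have "exp (\<mu> * t) * R 0 \<le> exp (\<mu> * t) * \<bar>R 0\<bar>"
    and "exp (\<mu> * t) * (- R 0) \<le> exp (\<mu> * t) * \<bar>R 0\<bar>"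
    by (intro mult_left_mono; simp)+
  ultimately show ?thesis
    using bn unfolding b_def[symmetric] abs_le_iff right_diff_distrib by linarith
qed

text \<open>The sum is, up to sign, what repeated integration by parts splits off from the variation
  of constants integral. The remainder \<open>R\<close> obeys the filter equation with forcing
  \<open>hderiv m u / \<mu> ^ m\<close>.\<close>

lemma filter_remainder_le:
  fixes w :: "real \<Rightarrow> real"
  assumes Ck: "Ck_halfline m u" and D: "\<And>t j. t \<ge> 0 \<Longrightarrow> j \<le> m \<Longrightarrow> \<bar>hderiv j u t\<bar> \<le> D"
    and w: "\<And>t. t \<ge> 0 \<Longrightarrow> (w has_real_derivative \<mu> * w t + u t) (at t within {0..})"
    and \<mu>: "\<mu> < 0" and t: "t \<ge> 0"
  shows "\<bar>w t + (\<Sum>j<m. hderiv j u t / \<mu> ^ Suc j)\<bar>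
    \<le> exp (\<mu> * t) * \<bar>w 0 + (\<Sum>j<m. hderiv j u 0 / \<mu> ^ Suc j)\<bar> + D / \<bar>\<mu>\<bar> ^ Suc m"
proof -
  define R where "R t = w t + (\<Sum>j<m. hderiv j u t / \<mu> ^ Suc j)" for t
  have "\<bar>R t\<bar> \<le> exp (\<mu> * t) * \<bar>R 0\<bar> + (D / \<bar>\<mu>\<bar> ^ m) / \<bar>\<mu>\<bar>"
  proof (rule abs_exp_comparison[OF _ _ \<mu> t, where d = "\<lambda>s. hderiv m u s / \<mu> ^ m"])
    fix s :: real assume s: "s \<ge> 0"
    have "(R has_real_derivative (\<mu> * w s + u s) + (\<Sum>j<m. hderiv (Suc j) u s / \<mu> ^ Suc j)) (at s within {0..})"
      unfolding R_def using s
      by (intro DERIV_add w DERIV_sum DERIV_cdivide hderiv_has_real_derivative[OF Ck]) auto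
    \<comment> \<open>The derivatives of the summands are the terms of \<open>\<mu> * R s\<close>
      moved up by one index: the new index \<open>m\<close> is the forcing, and the missing index 0
      is supplied by \<open>u s\<close>.\<close>
    moreover have "(\<mu> * w s + u s) + (\<Sum>j<m. hderiv (Suc j) u s / \<mu> ^ Suc j)
        = \<mu> * R s + hderiv m u s / \<mu> ^ m"
    proof -
      have "(\<Sum>j<Suc m. hderiv j u s / \<mu> ^ j) = u s + (\<Sum>j<m. hderiv (Suc j) u s / \<mu> ^ Suc j)"
        by (subst sum.lessThan_Suc_shift) (simp add: hderiv_def)
      moreover have "(\<Sum>j<m. hderiv j u s / \<mu> ^ j) = \<mu> * (\<Sum>j<m. hderiv j u s / \<mu> ^ Suc j)"
        using \<mu> by (simp add: sum_distrib_left)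
      ultimately show ?thesis by (simp add: R_def algebra_simps)
    qed
    ultimately show "(R has_real_derivative \<mu> * R s + hderiv m u s / \<mu> ^ m) (at s within {0..})"
      by simp
    show "\<bar>hderiv m u s / \<mu> ^ m\<bar> \<le> D / \<bar>\<mu>\<bar> ^ m"
      using D[OF s, of m] by (simp add: power_abs divide_right_mono)
  qed
  then show ?thesis by (simp add: R_def field_simps)
qed

text \<open>A single term of the exponential series is at most its sum.\<close>

lemma exp_minus_le_fact_over_power:
  fixes x :: real
  assumes "x > 0"
  shows "exp (- x) \<le> fact n / x ^ n"
proof -
  have "(\<lambda>k. x ^ k /\<^sub>R fact k) sums exp x" by (rule exp_converges)
  then have "(\<Sum>k\<in>{n}. x ^ k /\<^sub>R fact k) \<le> exp x"
    using assms by (intro sum_le_suminf[of _ "{n}", THEN order_trans]) (auto simp: sums_iff)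
  then have "x ^ n \<le> fact n * exp x" by (simp add: field_simps)
  then show ?thesis using assms by (simp add: exp_minus field_simps)
qed

text \<open>From time \<tau> on the transient is exponentially small in \<open>k\<close>, hence
  below any power of \<open>1 / k\<close>; the forcing is of order \<open>1 / k ^ Suc m\<close>
  already. \<open>K\<close> is fixed before \<open>k\<close>, \<open>w\<close> and
  \<open>t\<close>.\<close>

lemma filter_remainder_order:
  fixes l \<tau> w0 :: real
  assumes Ck: "Ck_halfline m u" and D: "\<And>t j. t \<ge> 0 \<Longrightarrow> j \<le> m \<Longrightarrow> \<bar>hderiv j u t\<bar> \<le> D"
    and l: "l < 0" and \<tau>: "\<tau> > 0"
  obtains K where "0 \<le> K"
    and "\<And>k w t. k * \<bar>l\<bar> \<ge> 1 \<Longrightarrow> w 0 = w0 \<Longrightarrow>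
      (\<And>t. t \<ge> 0 \<Longrightarrow> (w has_real_derivative (k * l) * w t + u t) (at t within {0..})) \<Longrightarrow> t \<ge> \<tau> \<Longrightarrow>
      \<bar>w t + (\<Sum>j<m. hderiv j u t / (k * l) ^ Suc j)\<bar> \<le> K / k ^ Suc m"
proof -
  define R0 where "R0 = \<bar>w0\<bar> + real m * D"
  define K where "K = fact (Suc m) / (\<bar>l\<bar> * \<tau>) ^ Suc m * R0 + D / \<bar>l\<bar> ^ Suc m"
  have D0: "0 \<le> D" using D[of 0 0] by auto
  then have R0: "0 \<le> R0" by (simp add: R0_def)
  show thesis
  proof (rule that[of K])
    show "0 \<le> K" unfolding K_def using D0 R0 \<tau> by (intro add_nonneg_nonneg mult_nonneg_nonneg divide_nonneg_nonneg) auto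
  next
    fix k :: real and w t
    assume k: "k * \<bar>l\<bar> \<ge> 1" and w0: "w 0 = w0" and t: "t \<ge> \<tau>"
      and w: "\<And>t. t \<ge> 0 \<Longrightarrow> (w has_real_derivative (k * l) * w t + u t) (at t within {0..})"
    have k0: "k > 0"
    proof (rule ccontr)
      assume "\<not> k > 0"
      then have "k * \<bar>l\<bar> \<le> 0" by (simp add: mult_nonpos_nonneg)
      then show False using k by linarith
    qed
    have kl: "k * l < 0" and akl: "\<bar>k * l\<bar> = k * \<bar>l\<bar>" using k0 l by (auto simp: mult_pos_neg abs_mult)
    \<comment> \<open>The condition \<open>k * \<bar>l\<bar> \<ge> 1\<close> makes all denominators
      at least 1 in absolute value, so the initial remainder is at most \<open>R0\<close> for every
      such \<open>k\<close>.\<close>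
    have "\<bar>hderiv j u 0 / (k * l) ^ Suc j\<bar> \<le> D" if "j < m" for j
    proof -
      have "\<bar>hderiv j u 0 / (k * l) ^ Suc j\<bar> = \<bar>hderiv j u 0\<bar> / (k * \<bar>l\<bar>) ^ Suc j"
        by (simp only: abs_divide power_abs akl)
      also have "\<dots> \<le> D / 1"
        using D[of 0 j] that D0 one_le_power[OF k, of "Suc j"] by (intro frac_le) auto
      finally show ?thesis by simp
    qed
    then have "(\<Sum>j<m. \<bar>hderiv j u 0 / (k * l) ^ Suc j\<bar>) \<le> of_nat (card {..<m}) * D"
      by (intro sum_bounded_above) blast
    then have "\<bar>\<Sum>j<m. hderiv j u 0 / (k * l) ^ Suc j\<bar> \<le> real m * D"
      unfolding card_lessThan by (rule order_trans[OF sum_abs])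
    then have r0: "\<bar>w 0 + (\<Sum>j<m. hderiv j u 0 / (k * l) ^ Suc j)\<bar> \<le> R0"
      unfolding R0_def w0 by linarith
    have "exp (k * l * t) \<le> exp (- (k * \<bar>l\<bar> * \<tau>))"
      using mult_left_mono_neg[OF t, of "k * l"] kl l by simp
    also have "\<dots> \<le> fact (Suc m) / (k * \<bar>l\<bar> * \<tau>) ^ Suc m"
      using k0 l \<tau> by (intro exp_minus_le_fact_over_power mult_pos_pos) auto
    finally have e: "exp (k * l * t) \<le> fact (Suc m) / (k * \<bar>l\<bar> * \<tau>) ^ Suc m" .
    have "\<bar>w t + (\<Sum>j<m. hderiv j u t / (k * l) ^ Suc j)\<bar>
      \<le> exp (k * l * t) * \<bar>w 0 + (\<Sum>j<m. hderiv j u 0 / (k * l) ^ Suc j)\<bar> + D / \<bar>k * l\<bar> ^ Suc m"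
      by (rule filter_remainder_le[OF Ck D w kl]) (use t \<tau> in auto)
    also have "\<dots> \<le> fact (Suc m) / (k * \<bar>l\<bar> * \<tau>) ^ Suc m * R0 + D / (k * \<bar>l\<bar>) ^ Suc m"
      unfolding akl
      by (intro add_right_mono mult_mono e r0 order_trans[OF exp_ge_zero e] abs_ge_zero)
    also have "\<dots> = K / k ^ Suc m"
    proof -
      have "a / (k * \<bar>l\<bar> * \<tau>) ^ Suc m = a / (\<bar>l\<bar> * \<tau>) ^ Suc m / k ^ Suc m"
        "a / (k * \<bar>l\<bar>) ^ Suc m = a / \<bar>l\<bar> ^ Suc m / k ^ Suc m" for a
        by (simp_all only: power_mult_distrib divide_divide_eq_left mult_ac)
      then show ?thesis unfolding K_def by (simp only: add_divide_distrib times_divide_eq_left)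
    qed
    finally show "\<bar>w t + (\<Sum>j<m. hderiv j u t / (k * l) ^ Suc j)\<bar> \<le> K / k ^ Suc m" .
  qed
qed

section \<open>Expansion of the mapping\<close>

text \<open>The recursion suits the expansion of the resolvent; \<open>jet_eq_sum\<close> unrolls it
  to match \<open>frakH\<close>.\<close>

primrec jet ::
  "real ^ 'n ^ 'n \<Rightarrow> real ^ 'n \<Rightarrow> real ^ 'n \<Rightarrow> (nat \<Rightarrow> real) \<Rightarrow> nat \<Rightarrow> real ^ 'n" where
  "jet X b x v 0 = x"
| "jet X b x v (Suc j) = X *v jet X b x v j + v j *\<^sub>R b"

lemma funpow_shift:
  "i < r \<Longrightarrow> (shift r ^^ j) s i = (if j \<le> i then s (i - j) else 0)"
  by (induction j arbitrary: i) (auto simp: shift_def)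

lemma jet_eq_sum:
  "jet X b x v i = matpow X i *v x + (\<Sum>j=1..i. v (j - 1) *\<^sub>R (matpow X (i - j) *v b))"
proof (induction i)
  case 0
  show ?case by (simp add: matpow_def)
next
  case (Suc i)
  have pow: "matpow X (Suc m) *v y = X *v (matpow X m *v y)" for m y
    by (simp add: matpow_def matrix_vector_mul_assoc)
  have "(\<Sum>j=1..i. v (j - 1) *\<^sub>R (matpow X (Suc i - j) *v b))
      = (\<Sum>j=1..i. X *v (v (j - 1) *\<^sub>R (matpow X (i - j) *v b)))"
    by (intro sum.cong refl) (simp add: Suc_diff_le pow matrix_vector_mult_scaleR)
  also have "\<dots> = X *v (\<Sum>j=1..i. v (j - 1) *\<^sub>R (matpow X (i - j) *v b))"
    by (simp add: linear_sum[OF matrix_vector_mul_linear])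
  finally show ?case
    by (simp add: Suc pow matrix_vector_right_distrib) (simp add: matpow_def)
qed

lemma frakH_eq_jet:
  assumes "i < r"
  shows "frakH A B C r x \<theta> v i = C \<theta> \<bullet> jet (A \<theta>) (B \<theta>) x v i"
proof -
  \<comment> \<open>The j-th power of the shift vanishes in component \<open>i\<close> once
    \<open>j > i\<close>, which cuts the sum off at \<open>i\<close>.\<close>
  have "(\<Sum>j=1..r-1. ((shift r ^^ j) (\<lambda>l. Hrow A C \<theta> l \<bullet> B \<theta>)) i * v (j - 1))
      = (\<Sum>j=1..i. ((shift r ^^ j) (\<lambda>l. Hrow A C \<theta> l \<bullet> B \<theta>)) i * v (j - 1))"
    using assms by (intro sum.mono_neutral_right) (auto simp: funpow_shift)
  also have "\<dots> = C \<theta> \<bullet> (\<Sum>j=1..i. v (j - 1) *\<^sub>R (matpow (A \<theta>) (i - j) *v B \<theta>))"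
    unfolding inner_sum_right using assms
    by (intro sum.cong refl) (simp add: funpow_shift Hrow_def dot_lmul_matrix)
  finally show ?thesis
    unfolding frakH_def jet_eq_sum by (simp add: Hrow_def dot_lmul_matrix inner_add_right)
qed

text \<open>
  The jet consists of the formal derivatives of a solution, so that the resolvent, which inverts
  \<open>d/dt - \<mu>\<close> formally, can be expanded by repeated integration by parts.
\<close>

lemma resolvent_jet_expansion:
  fixes X :: "real ^ 'n ^ 'n"
  assumes inv: "invertible (X - \<mu> *\<^sub>R mat 1)" and \<mu>: "\<mu> \<noteq> 0"
  defines "N \<equiv> matrix_inv (X - \<mu> *\<^sub>R mat 1)"
  shows "c \<bullet> (N *v x) = - (\<Sum>j<m. c \<bullet> jet X b x v j / \<mu> ^ Suc j)
    + c \<bullet> (N *v jet X b x v m) / \<mu> ^ m - (\<Sum>j<m. v j / \<mu> ^ Suc j) * (c \<bullet> (N *v b))"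
    and "c \<bullet> (N *v y) = (c \<bullet> (N *v (X *v y)) - c \<bullet> y) / \<mu>"
proof -
  have *: "c \<bullet> (N *v y) = (c \<bullet> (N *v (X *v y)) - c \<bullet> y) / \<mu>" for y
  proof -
    have "N *v (X *v y) - \<mu> *\<^sub>R (N *v y) = N *v ((X - \<mu> *\<^sub>R mat 1) *v y)"
      by (simp add: matrix_vector_mult_diff_rdistrib matrix_vector_mult_diff_distrib
          matrix_vector_mult_scaleR flip: scaleR_matrix_vector_assoc)
    also have "\<dots> = y" unfolding N_def by (rule matrix_inv_mult_vec(2)[OF inv])
    finally have "c \<bullet> (N *v (X *v y)) - \<mu> * (c \<bullet> (N *v y)) = c \<bullet> y"
      by (simp flip: inner_diff_right inner_scaleR_right)
    then show ?thesis using \<mu> by (simp add: field_simps)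
  qed
  then show "c \<bullet> (N *v y) = (c \<bullet> (N *v (X *v y)) - c \<bullet> y) / \<mu>" .
  show "c \<bullet> (N *v x) = - (\<Sum>j<m. c \<bullet> jet X b x v j / \<mu> ^ Suc j)
    + c \<bullet> (N *v jet X b x v m) / \<mu> ^ m - (\<Sum>j<m. v j / \<mu> ^ Suc j) * (c \<bullet> (N *v b))"
  proof (induction m)
    case (Suc m)
    define \<xi> where "\<xi> = jet X b x v m"
    have "c \<bullet> (N *v jet X b x v (Suc m)) = c \<bullet> (N *v (X *v \<xi>)) + v m * (c \<bullet> (N *v b))"
      by (simp add: \<xi>_def matrix_vector_right_distrib matrix_vector_mult_scaleR inner_add_right)
    then have "c \<bullet> (N *v \<xi>) = (c \<bullet> (N *v jet X b x v (Suc m)) - v m * (c \<bullet> (N *v b)) - c \<bullet> \<xi>) / \<mu>"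
      using *[of \<xi>] by simp
    \<comment> \<open>The end term after \<open>m\<close> steps is the end term after
      \<open>Suc m\<close> steps minus one new summand of each of the two sums.\<close>
    then have "c \<bullet> (N *v \<xi>) / \<mu> ^ m = c \<bullet> (N *v jet X b x v (Suc m)) / \<mu> ^ Suc m
        - v m / \<mu> ^ Suc m * (c \<bullet> (N *v b)) - c \<bullet> \<xi> / \<mu> ^ Suc m"
      by (simp add: diff_divide_distrib)
    then show ?case using Suc unfolding \<xi>_def[symmetric] sum.lessThan_Suc distrib_right by linarith
  qed simp
qed

text \<open>The last of the \<open>Suc m\<close> expansion steps uses \<open>A \<theta>\<close>
  applied to the m-th jet component instead of the next component, which would involve
  \<open>v m\<close>. Thus \<open>v\<close> is read only below \<open>m\<close>.\<close>

lemma T_expansion: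
  assumes inv: "invertible (A \<theta> - l i *\<^sub>R mat 1)" and l: "l i \<noteq> 0"
  defines "N \<equiv> matrix_inv (A \<theta> - l i *\<^sub>R mat 1)"
  shows "T A B C l x \<theta> w i + (\<Sum>j<Suc m. frakH A B C (Suc m) x \<theta> v j / l i ^ Suc j)
    = C \<theta> \<bullet> (N *v (A \<theta> *v jet (A \<theta>) (B \<theta>) x v m)) / l i ^ Suc m
      - (w i + (\<Sum>j<m. v j / l i ^ Suc j)) * (C \<theta> \<bullet> (N *v B \<theta>))"
proof -
  define J where "J = jet (A \<theta>) (B \<theta>) x v"
  have T: "T A B C l x \<theta> w i = C \<theta> \<bullet> (N *v x) - w i * (C \<theta> \<bullet> (N *v B \<theta>))"
    by (simp add: T_def M_def N_def dot_lmul_matrix matrix_vector_mult_diff_distrib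
        matrix_vector_mult_scaleR inner_diff_right)
  have H: "(\<Sum>j<Suc m. frakH A B C (Suc m) x \<theta> v j / l i ^ Suc j)
      = (\<Sum>j<m. C \<theta> \<bullet> J j / l i ^ Suc j) + C \<theta> \<bullet> J m / l i ^ Suc m"
    by (simp add: frakH_eq_jet J_def)
  have "C \<theta> \<bullet> (N *v J m) / l i ^ m
      = C \<theta> \<bullet> (N *v (A \<theta> *v J m)) / l i ^ Suc m - C \<theta> \<bullet> J m / l i ^ Suc m"
    using resolvent_jet_expansion(2)[OF inv l, of "C \<theta>" "J m"]
    by (simp add: N_def diff_divide_distrib)
  then show ?thesis
    using resolvent_jet_expansion(1)[OF inv l, where c = "C \<theta>" and x = x and m = m and b = "B \<theta>" and v = v]
    unfolding T H N_def[symmetric] J_def[symmetric] distrib_right by linarith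
qed

section \<open>Lipschitz bounds for the remainder of the expansion\<close>

text \<open>The constant depends on \<open>v\<close> only through the bound \<open>V\<close>, so
  with \<open>V\<close> bounding the derivatives of the input it is uniform in time.\<close>

lemma blip_jet:
  fixes X :: "'p::real_normed_vector \<Rightarrow> real ^ 'n ^ 'n"
  assumes X: "blip a S X" "0 \<le> a" and b: "blip \<beta> S b" "0 \<le> \<beta>" and x: "blip \<xi> S x" "0 \<le> \<xi>"
    and V: "0 \<le> V"
  shows "\<exists>K\<ge>0. \<forall>v. (\<forall>j<m. \<bar>v j\<bar> \<le> V) \<longrightarrow> blip K S (\<lambda>p. jet (X p) (b p) (x p) v m)"
proof (induction m)
  case 0
  show ?case using x by auto
next
  case (Suc m)
  then obtain K where K: "K \<ge> 0" and
    KJ: "\<And>v. \<forall>j<m. \<bar>v j\<bar> \<le> V \<Longrightarrow> blip K S (\<lambda>p. jet (X p) (b p) (x p) v m)" by blast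
  show ?case
  proof (intro exI[of _ "2 * a * K + V * \<beta>"] conjI allI impI)
    show "0 \<le> 2 * a * K + V * \<beta>" using K X(2) V b(2) by simp
    fix v :: "nat \<Rightarrow> real" assume v: "\<forall>j<Suc m. \<bar>v j\<bar> \<le> V"
    have "blip (\<bar>v m\<bar> * \<beta>) S (\<lambda>p. v m *\<^sub>R b p)" using b(1) by (rule blip_scaleR)
    then have "blip (V * \<beta>) S (\<lambda>p. v m *\<^sub>R b p)"
      by (rule blip_mono) (use v b(2) in \<open>auto intro: mult_right_mono\<close>)
    moreover have "blip (2 * a * K) S (\<lambda>p. X p *v jet (X p) (b p) (x p) v m)"
      using X KJ[of v] v
      by (intro blip_bilinear[OF bounded_bilinear_matrix_vector_mult norm_matrix_vector_mult_le]) auto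
    ultimately show "blip (2 * a * K + V * \<beta>) S (\<lambda>p. jet (X p) (b p) (x p) v (Suc m))"
      unfolding jet.simps by (rule blip_add[rotated])
  qed
qed

lemma blip_inner_resolvent:
  fixes X :: "'p::real_normed_vector \<Rightarrow> real ^ 'n ^ 'n"
  assumes X: "blip a S X" and c: "blip \<gamma> S c" "0 \<le> \<gamma>" and g: "blip K S g" "0 \<le> K"
    and \<mu>: "2 * a \<le> \<bar>\<mu>\<bar>" "\<mu> \<noteq> 0"
  shows "blip (8 * \<gamma> * K / \<bar>\<mu>\<bar>) S (\<lambda>p. c p \<bullet> (matrix_inv (X p - \<mu> *\<^sub>R mat 1) *v g p))"
proof -
  have "blip (2 * \<gamma> * (4 * K / \<bar>\<mu>\<bar>)) S (\<lambda>p. c p \<bullet> (matrix_inv (X p - \<mu> *\<^sub>R mat 1) *v g p))"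
    using Cauchy_Schwarz_ineq2 c blip_resolvent[OF X g \<mu>]
    by (intro blip_bilinear[OF bounded_bilinear_inner]) auto
  then show ?thesis by (rule blip_mono) simp
qed

text \<open>Both terms on the right of \<open>T_expansion\<close> carry \<open>1 / k ^ Suc m\<close>
  and gain another \<open>1 / k\<close> from the resolvent, one power more than the lower bound for
  the main term. In the condition on \<open>k\<close>, the 1 serves the filter bound and
  \<open>2 * a\<close> the resolvent bound.\<close>

lemma blip_T_remainder:
  fixes A :: "'t::real_normed_vector \<Rightarrow> real ^ 'n ^ 'n" and S :: "((real ^ 'n) \<times> 't) set"
  assumes A: "blip a S (\<lambda>p. A (snd p))" "0 \<le> a" and B: "blip \<beta> S (\<lambda>p. B (snd p))" "0 \<le> \<beta>"
    and C: "blip \<gamma> S (\<lambda>p. C (snd p))" "0 \<le> \<gamma>" and X: "blip \<xi> S fst" "0 \<le> \<xi>"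
    and Ck: "Ck_halfline m u" and D: "\<And>t j. t \<ge> 0 \<Longrightarrow> j \<le> m \<Longrightarrow> \<bar>hderiv j u t\<bar> \<le> D"
    and l: "l i < 0" and \<tau>: "\<tau> > 0"
  shows "\<exists>K\<ge>0. \<forall>k w t. 1 + 2 * a \<le> k * \<bar>l i\<bar> \<longrightarrow> w 0 i = w0 \<longrightarrow>
      (\<forall>t\<ge>0. ((\<lambda>s. w s i) has_real_derivative (k * l i) * w t i + u t) (at t within {0..})) \<longrightarrow> t \<ge> \<tau> \<longrightarrow>
      blip (K / k ^ Suc (Suc m)) S (\<lambda>p. T A B C (\<lambda>i. k * l i) (fst p) (snd p) (w t) i +
        (\<Sum>j<Suc m. frakH A B C (Suc m) (fst p) (snd p) (restrict (\<lambda>j. hderiv j u t) {..<m}) j / (k * l i) ^ Suc j))"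
proof -
  have D0: "0 \<le> D" using D[of 0 0] by auto
  obtain K1 where K1: "0 \<le> K1"
    and jet: "\<And>v. \<forall>j<m. \<bar>v j\<bar> \<le> D \<Longrightarrow> blip K1 S (\<lambda>p. jet (A (snd p)) (B (snd p)) (fst p) v m)"
    using blip_jet[OF A B X D0, of m] by blast
  obtain K2 where K2: "0 \<le> K2"
    and fil: "\<And>k w t. k * \<bar>l i\<bar> \<ge> 1 \<Longrightarrow> w 0 = w0 \<Longrightarrow>
      (\<And>t. t \<ge> 0 \<Longrightarrow> (w has_real_derivative (k * l i) * w t + u t) (at t within {0..})) \<Longrightarrow> t \<ge> \<tau> \<Longrightarrow>
      \<bar>w t + (\<Sum>j<m. hderiv j u t / (k * l i) ^ Suc j)\<bar> \<le> K2 / k ^ Suc m"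
    using filter_remainder_order[OF Ck D l \<tau>, where ?w0.0 = w0] by blast
  \<comment> \<open>Up to the factor \<open>1 / \<bar>\<mu>\<bar>\<close>, these are the constants
    of \<open>F1\<close> and \<open>F2\<close> below; \<open>2 * a * K1\<close> belongs to
    \<open>A\<close> applied to the jet.\<close>
  define E1 where "E1 = 8 * \<gamma> * (2 * a * K1)"
  define E2 where "E2 = 8 * \<gamma> * \<beta>"
  have E: "0 \<le> E1" "0 \<le> E2" unfolding E1_def E2_def using A B C K1 by auto
  define K where "K = E1 / \<bar>l i\<bar> ^ Suc (Suc m) + K2 * E2 / \<bar>l i\<bar>"
  have K0: "0 \<le> K" unfolding K_def using E K2 by simp
  have main: "blip (K / k ^ Suc (Suc m)) S (\<lambda>p. T A B C (\<lambda>i. k * l i) (fst p) (snd p) (w t) i +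
        (\<Sum>j<Suc m. frakH A B C (Suc m) (fst p) (snd p) (restrict (\<lambda>j. hderiv j u t) {..<m}) j / (k * l i) ^ Suc j))"
    (is "blip _ S ?F")
    if k: "1 + 2 * a \<le> k * \<bar>l i\<bar>" and w0: "w 0 i = w0" and t: "t \<ge> \<tau>"
      and w: "\<forall>t\<ge>0. ((\<lambda>s. w s i) has_real_derivative (k * l i) * w t i + u t) (at t within {0..})"
    for k w t
  proof -
    define \<mu> where "\<mu> = k * l i"
    define v where "v = restrict (\<lambda>j. hderiv j u t) {..<m}"
    define R where "R = w t i + (\<Sum>j<m. v j / \<mu> ^ Suc j)"
    define F1 where "F1 p = C (snd p) \<bullet> (matrix_inv (A (snd p) - \<mu> *\<^sub>R mat 1) *v
      (A (snd p) *v jet (A (snd p)) (B (snd p)) (fst p) v m))" for p :: "(real ^ 'n) \<times> 't"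
    define F2 where "F2 p = C (snd p) \<bullet> (matrix_inv (A (snd p) - \<mu> *\<^sub>R mat 1) *v B (snd p))" for p :: "(real ^ 'n) \<times> 't"
    have k0: "0 < k"
    proof (rule ccontr)
      assume "\<not> k > 0"
      then have "k * \<bar>l i\<bar> \<le> 0" by (simp add: mult_nonpos_nonneg)
      then show False using k A(2) by linarith
    qed
    have amu: "\<bar>\<mu>\<bar> = k * \<bar>l i\<bar>" using k0 by (simp add: \<mu>_def abs_mult)
    have mu: "2 * a \<le> \<bar>\<mu>\<bar>" "\<mu> \<noteq> 0" using k k0 l amu by (auto simp: \<mu>_def)
    have v: "\<bar>v j\<bar> \<le> D" if "j < m" for j using D[of t j] that t \<tau> by (simp add: v_def)
    have "blip (2 * a * K1) S (\<lambda>p. A (snd p) *v jet (A (snd p)) (B (snd p)) (fst p) v m)"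
      using A jet[of v] v
      by (intro blip_bilinear[OF bounded_bilinear_matrix_vector_mult norm_matrix_vector_mult_le]) auto
    then have "blip (E1 / \<bar>\<mu>\<bar>) S F1"
      unfolding E1_def F1_def using A K1 by (intro blip_inner_resolvent[OF A(1) C _ _ mu]) auto
    then have "blip (\<bar>1 / \<mu> ^ Suc m\<bar> * (E1 / \<bar>\<mu>\<bar>)) S (\<lambda>p. (1 / \<mu> ^ Suc m) *\<^sub>R F1 p)"
      by (rule blip_scaleR)
    moreover have "\<bar>1 / \<mu> ^ Suc m\<bar> * (E1 / \<bar>\<mu>\<bar>) = E1 / \<bar>l i\<bar> ^ Suc (Suc m) / k ^ Suc (Suc m)"
      by (simp add: amu abs_mult power_abs power_mult_distrib)
    ultimately have F1: "blip (E1 / \<bar>l i\<bar> ^ Suc (Suc m) / k ^ Suc (Suc m)) S (\<lambda>p. (1 / \<mu> ^ Suc m) *\<^sub>R F1 p)"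
      by (simp only:)
    have "blip (E2 / \<bar>\<mu>\<bar>) S F2"
      unfolding E2_def F2_def by (rule blip_inner_resolvent[OF A(1) C B mu])
    then have "blip (\<bar>- R\<bar> * (E2 / \<bar>\<mu>\<bar>)) S (\<lambda>p. (- R) *\<^sub>R F2 p)" by (rule blip_scaleR)
    moreover have "\<bar>- R\<bar> * (E2 / \<bar>\<mu>\<bar>) \<le> K2 * E2 / \<bar>l i\<bar> / k ^ Suc (Suc m)"
    proof -
      \<comment> \<open>\<open>restrict\<close> gives \<open>undefined\<close> from index
        \<open>m\<close> on; only smaller indices occur here.\<close>
      have "(\<Sum>j<m. v j / \<mu> ^ Suc j) = (\<Sum>j<m. hderiv j u t / \<mu> ^ Suc j)"
        by (intro sum.cong) (auto simp: v_def)
      then have "\<bar>R\<bar> \<le> K2 / k ^ Suc m"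
        unfolding R_def \<mu>_def using fil[of k "\<lambda>s. w s i" t] k A(2) w0 w t by simp
      then have "\<bar>- R\<bar> * (E2 / \<bar>\<mu>\<bar>) \<le> K2 / k ^ Suc m * (E2 / \<bar>\<mu>\<bar>)"
        using E by (intro mult_right_mono) auto
      also have "\<dots> = K2 * E2 / \<bar>l i\<bar> / k ^ Suc (Suc m)" by (simp add: amu mult_ac)
      finally show ?thesis .
    qed
    ultimately have F2: "blip (K2 * E2 / \<bar>l i\<bar> / k ^ Suc (Suc m)) S (\<lambda>p. (- R) *\<^sub>R F2 p)"
      by (rule blip_mono)
    have "?F p = (1 / \<mu> ^ Suc m) *\<^sub>R F1 p + (- R) *\<^sub>R F2 p" if p: "p \<in> S" for p
    proof -
      have "2 * norm (A (snd p)) \<le> \<bar>\<mu>\<bar>" using A(1) p mu(1) unfolding blip_def by force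
      then have "invertible (A (snd p) - \<mu> *\<^sub>R mat 1)" using mu(2) by (rule invertible_shifted_matrix)
      then show ?thesis
        using T_expansion[of A "snd p" "\<lambda>i. k * l i" i B C "fst p" "w t" m v] mu(2)
        unfolding \<mu>_def[symmetric] v_def[symmetric] R_def[symmetric] F1_def F2_def by simp
    qed
    \<comment> \<open>The identity is available only on \<open>S\<close>, where \<open>a\<close>
      bounds \<open>A\<close>, and \<open>blip\<close> looks at no other points.\<close>
    then have "blip L S ?F \<longleftrightarrow> blip L S (\<lambda>p. (1 / \<mu> ^ Suc m) *\<^sub>R F1 p + (- R) *\<^sub>R F2 p)" for L
      unfolding blip_def by simp
    then show ?thesis using blip_add[OF F1 F2] by (simp add: K_def add_divide_distrib)
  qed
  show ?thesis using K0 main by blast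
qed

section \<open>Choice of the constants and absorption of the remainder\<close>

theorem theorem2:
  fixes \<Theta> :: "(real ^ 'q) set"
    and A :: "real ^ 'q \<Rightarrow> real ^ 'n ^ 'n"
    and B :: "real ^ 'q \<Rightarrow> real ^ 'n"
    and C :: "real ^ 'q \<Rightarrow> real ^ 'n"
    and Ctheta :: "(real ^ 'q) set"
    and Cx :: "(real ^ 'n) set"
    and r :: nat
    and U :: "(nat \<Rightarrow> real) set"
    and LH :: real
    and u :: "real \<Rightarrow> real"
    and ubd :: real
  assumes "C1_on \<Theta> A" and "C1_on \<Theta> B" and "C1_on \<Theta> C"
    and "open Ctheta" and "bounded Ctheta" and "closure Ctheta \<subseteq> \<Theta>"
    and "open Cx" and "bounded Cx"
    and "r > 0"
    and "U \<subseteq> ({..<r-1} \<rightarrow>\<^sub>E UNIV)" and "\<exists>K. \<forall>v\<in>U. L2_set v {..<r-1} \<le> K"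
    and "LH > 0"
    and "\<And>x \<theta> x' \<theta>' v. x \<in> closure Cx \<Longrightarrow> \<theta> \<in> closure Ctheta \<Longrightarrow> x' \<in> closure Cx \<Longrightarrow>
           \<theta>' \<in> closure Ctheta \<Longrightarrow> v \<in> U \<Longrightarrow>
           L2_set (\<lambda>i. frakH A B C r x' \<theta>' v i - frakH A B C r x \<theta> v i) {..<r}
             \<ge> LH * norm (x - x', \<theta> - \<theta>')"
    and "Ck_halfline (r - 1) u"
    and "ubd > 0" and "\<And>t. t \<ge> 0 \<Longrightarrow> L2_set (\<lambda>j. hderiv j u t) {..<r} \<le> ubd"
  shows "\<forall>l :: nat \<Rightarrow> real. (\<forall>i<r. l i < 0) \<longrightarrow> inj_on l {..<r} \<longrightarrow>
    (\<forall>\<tau>>0. \<forall>w0 :: nat \<Rightarrow> real. \<exists>kstar>0. \<exists>LT>0. \<forall>k>kstar.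
       (\<forall>\<theta>\<in>Ctheta. T_defined_at A r (\<lambda>i. k * l i) \<theta>) \<and>
       (\<forall>w. filter_solution r (\<lambda>i. k * l i) u w0 w \<longrightarrow>
          (\<forall>t1\<ge>\<tau>. restrict (\<lambda>j. hderiv j u t1) {..<r-1} \<in> U \<longrightarrow>
             (\<forall>x\<in>Cx. \<forall>\<theta>\<in>Ctheta. \<forall>x'\<in>Cx. \<forall>\<theta>'\<in>Ctheta.
                L2_set (\<lambda>i. T A B C (\<lambda>i. k * l i) x \<theta> (w t1) i
                            - T A B C (\<lambda>i. k * l i) x' \<theta>' (w t1) i) {..<r}
                  \<ge> LT / k ^ r * norm (x - x', \<theta> - \<theta>')))))"
proof (intro allI impI)
  fix l w0 :: "nat \<Rightarrow> real" and \<tau> :: real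
  assume l: "\<forall>i<r. l i < 0" and inj: "inj_on l {..<r}" and \<tau>: "\<tau> > 0"
  define m where "m = r - 1"
  have r: "r = Suc m" using \<open>r > 0\<close> by (simp add: m_def)
  define S where "S = Cx \<times> Ctheta"
  have S: "S \<subseteq> UNIV \<times> Ctheta" by (auto simp: S_def)
  \<comment> \<open>Taking \<open>UNIV\<close> instead of \<open>Cx\<close> makes the bound on
    \<open>A\<close> available on all of \<open>Ctheta\<close> even if \<open>Cx\<close> is
    empty.\<close>
  obtain a where a: "0 \<le> a" "blip a (UNIV \<times> Ctheta :: ((real ^ 'n) \<times> _) set) (\<lambda>p. A (snd p))"
    using C1_on_imp_blip[OF assms(1,5,6)] .
  obtain \<beta> where \<beta>: "0 \<le> \<beta>" "blip \<beta> (UNIV \<times> Ctheta :: ((real ^ 'n) \<times> _) set) (\<lambda>p. B (snd p))"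
    using C1_on_imp_blip[OF assms(2,5,6)] .
  obtain \<gamma> where \<gamma>: "0 \<le> \<gamma>" "blip \<gamma> (UNIV \<times> Ctheta :: ((real ^ 'n) \<times> _) set) (\<lambda>p. C (snd p))"
    using C1_on_imp_blip[OF assms(3,5,6)] .
  obtain b where b: "\<And>x. x \<in> Cx \<Longrightarrow> norm x \<le> b" using \<open>bounded Cx\<close> unfolding bounded_iff by blast
  have "blip (max 1 b) S fst"
    unfolding blip_def
  proof (intro conjI ballI)
    fix p q assume p: "p \<in> S"
    then show "norm (fst p) \<le> max 1 b" using b by (force simp: S_def)
    have "norm (fst (p - q)) \<le> norm (p - q)"
      using norm_fst_le[of "fst (p - q)" "snd (p - q)"] unfolding prod.collapse .
    then have "norm (fst p - fst q) \<le> norm (p - q)" by simp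
    also have "\<dots> \<le> max 1 b * norm (p - q)"
      using mult_right_mono[of 1 "max 1 b" "norm (p - q)"] by simp
    finally show "norm (fst p - fst q) \<le> max 1 b * norm (p - q)" .
  qed
  then obtain \<xi> where \<xi>: "0 \<le> \<xi>" "blip \<xi> S fst"
    by (intro that[of "max 1 b"]) auto
  have D: "\<bar>hderiv j u t\<bar> \<le> ubd" if "t \<ge> 0" "j \<le> m" for t j
    using member_le_L2_set[of "{..<r}" j "\<lambda>j. \<bar>hderiv j u t\<bar>"] assms(16)[OF that(1)] that(2)
    by (simp add: L2_set_def r)
  have Ck: "Ck_halfline m u" using assms(14) by (simp add: m_def)
  define v where "v t = restrict (\<lambda>j. hderiv j u t) {..<m}" for t
  define G where "G k t p i = (\<Sum>j<r. frakH A B C r (fst p) (snd p) (v t) j / (k * l i) ^ Suc j)" for k t p i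
  \<comment> \<open>\<open>P\<close> names the property so that one constant per index
    \<open>i < r\<close> can be chosen.\<close>
  define P where "P i K \<longleftrightarrow> 0 \<le> K \<and> (\<forall>k w t. 1 + 2 * a \<le> k * \<bar>l i\<bar> \<longrightarrow> w 0 i = w0 i \<longrightarrow>
      (\<forall>t\<ge>0. ((\<lambda>s. w s i) has_real_derivative (k * l i) * w t i + u t) (at t within {0..})) \<longrightarrow> t \<ge> \<tau> \<longrightarrow>
      blip (K / k ^ Suc r) S (\<lambda>p. T A B C (\<lambda>i. k * l i) (fst p) (snd p) (w t) i + G k t p i))" for i K
  have "\<exists>K. P i K" if "i < r" for i
    unfolding P_def G_def v_def r
    by (intro blip_T_remainder[OF blip_subset[OF a(2) S] a(1) blip_subset[OF \<beta>(2) S] \<beta>(1)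
          blip_subset[OF \<gamma>(2) S] \<gamma>(1) \<xi>(2,1) Ck D _ \<tau>]) (use l that in auto)
  then obtain K where KP: "\<And>i. i < r \<Longrightarrow> P i (K i)" by metis
  have K: "0 \<le> K i" if "i < r" for i using KP[OF that] unfolding P_def by (rule conjunct1)
  have rem: "blip (K i / k ^ Suc r) S (\<lambda>p. T A B C (\<lambda>i. k * l i) (fst p) (snd p) (w t) i + G k t p i)"
    if "i < r" "1 + 2 * a \<le> k * \<bar>l i\<bar>" "w 0 i = w0 i" "t \<ge> \<tau>"
      "\<forall>t\<ge>0. ((\<lambda>s. w s i) has_real_derivative (k * l i) * w t i + u t) (at t within {0..})" for i k w t
    using KP[OF that(1)] that(2-) unfolding P_def by blast
  have nz: "l i \<noteq> 0" if "i < r" for i using l that by auto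
  obtain c where c: "c > 0"
    and vdm: "\<And>z. c * L2_set z {..<r} \<le> L2_set (\<lambda>i. \<Sum>j<r. z j / l i ^ Suc j) {..<r}"
    using L2_set_vandermonde_ge[OF inj nz] by blast
  \<comment> \<open>The main term yields \<open>c * LH\<close>, which is \<open>2 * LT\<close>, and
    the remainder may use up \<open>LT\<close>. The three summands of \<open>ks\<close> ensure
    \<open>k > 1\<close>, the condition of the remainder lemma for every \<open>i\<close>, and
    \<open>Ks / k \<le> LT\<close>.\<close>
  define Ks where "Ks = (\<Sum>i<r. K i)"
  define LT where "LT = c * LH / 2"
  define ks where "ks = 1 + (\<Sum>i<r. (1 + 2 * a) / \<bar>l i\<bar>) + Ks / LT"
  have LT: "LT > 0" using c \<open>LH > 0\<close> by (simp add: LT_def)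
  have Ks: "Ks \<ge> 0" using K by (auto simp: Ks_def intro: sum_nonneg)
  have terms: "0 \<le> (1 + 2 * a) / \<bar>l i\<bar>" for i using a(1) by simp
  have ks1: "ks \<ge> 1" using Ks LT sum_nonneg[of "{..<r}" "\<lambda>i. (1 + 2 * a) / \<bar>l i\<bar>"] terms by (simp add: ks_def)
  then have ks0: "ks > 0" by simp
  have large: "1 + 2 * a \<le> k * \<bar>l i\<bar>" if "k > ks" "i < r" for k i
  proof -
    have "(1 + 2 * a) / \<bar>l i\<bar> \<le> (\<Sum>i<r. (1 + 2 * a) / \<bar>l i\<bar>)"
      using that(2) terms by (intro member_le_sum) auto
    also have "\<dots> \<le> k" using that(1) Ks LT divide_nonneg_pos[OF Ks LT] unfolding ks_def by linarith
    finally show ?thesis using nz[OF that(2)] by (simp add: field_simps)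
  qed
  have Kk: "Ks / k \<le> LT" if "k > ks" for k
  proof -
    have "Ks / LT \<le> k"
      using that sum_nonneg[of "{..<r}" "\<lambda>i. (1 + 2 * a) / \<bar>l i\<bar>"] terms unfolding ks_def by fastforce
    then show ?thesis using LT that ks1 by (simp add: field_simps)
  qed
  show "\<exists>kstar>0. \<exists>LT>0. \<forall>k>kstar.
       (\<forall>\<theta>\<in>Ctheta. T_defined_at A r (\<lambda>i. k * l i) \<theta>) \<and>
       (\<forall>w. filter_solution r (\<lambda>i. k * l i) u w0 w \<longrightarrow>
          (\<forall>t1\<ge>\<tau>. restrict (\<lambda>j. hderiv j u t1) {..<r-1} \<in> U \<longrightarrow>
             (\<forall>x\<in>Cx. \<forall>\<theta>\<in>Ctheta. \<forall>x'\<in>Cx. \<forall>\<theta>'\<in>Ctheta.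
                L2_set (\<lambda>i. T A B C (\<lambda>i. k * l i) x \<theta> (w t1) i
                            - T A B C (\<lambda>i. k * l i) x' \<theta>' (w t1) i) {..<r}
                  \<ge> LT / k ^ r * norm (x - x', \<theta> - \<theta>'))))"
  proof (rule exI[of _ ks], rule conjI[OF ks0], rule exI[of _ LT], rule conjI[OF LT],
      intro conjI allI impI ballI)
    fix k \<theta> assume k: "ks < k" and \<theta>: "\<theta> \<in> Ctheta"
    show "T_defined_at A r (\<lambda>i. k * l i) \<theta>"
      unfolding T_defined_at_def
    proof (intro allI impI)
      fix i assume i: "i < r"
      have "norm (A \<theta>) \<le> a" using a(2) \<theta> unfolding blip_def by auto
      moreover have "\<bar>k * l i\<bar> = k * \<bar>l i\<bar>" using k ks1 by (simp add: abs_mult)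
      ultimately have "2 * norm (A \<theta>) \<le> \<bar>k * l i\<bar>" "k * l i \<noteq> 0"
        using large[OF k i] a(1) by auto
      then show "\<not> eigval (A \<theta>) (k * l i)" by (rule not_eigval_of_large)
    qed
  next
    fix k w t1 x \<theta> x' \<theta>'
    assume k: "ks < k" and w: "filter_solution r (\<lambda>i. k * l i) u w0 w" and t1: "\<tau> \<le> t1"
      and vU: "restrict (\<lambda>j. hderiv j u t1) {..<r-1} \<in> U"
      and x: "x \<in> Cx" "\<theta> \<in> Ctheta" "x' \<in> Cx" "\<theta>' \<in> Ctheta"
    have k1: "k > 1" using k ks1 by simp
    define \<delta> where "\<delta> = norm (x - x', \<theta> - \<theta>')"
    define p q where "p = (x, \<theta>)" and "q = (x', \<theta>')"
    have pq: "p \<in> S" "q \<in> S" using x by (auto simp: p_def q_def S_def)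
    define Td where "Td i = T A B C (\<lambda>i. k * l i) x \<theta> (w t1) i - T A B C (\<lambda>i. k * l i) x' \<theta>' (w t1) i" for i
    define F where "F p i = T A B C (\<lambda>i. k * l i) (fst p) (snd p) (w t1) i + G k t1 p i" for p i
    \<comment> \<open>\<open>d\<close> is oriented as in the hypothesis on \<open>frakH\<close>,
      opposite to \<open>Td\<close>; the signs agree because \<open>T\<close> equals the remainder
      \<open>F\<close> minus the sum \<open>G\<close>.\<close>
    define d where "d j = frakH A B C r x' \<theta>' (v t1) j - frakH A B C r x \<theta> (v t1) j" for j
    have vU': "v t1 \<in> U" using vU by (simp add: v_def m_def)
    have "LH * \<delta> \<le> L2_set d {..<r}"
      unfolding \<delta>_def d_def using x closure_subset[of Cx] closure_subset[of Ctheta]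
      by (intro assms(13) vU') auto
    then have "LH * \<delta> / k ^ r \<le> L2_set d {..<r} * (1 / k ^ r)"
      using k1 by (simp add: divide_right_mono)
    also have "L2_set d {..<r} * (1 / k ^ r) = L2_set (\<lambda>j. \<bar>d j\<bar> * (1 / k ^ r)) {..<r}"
      using k1 by (subst L2_set_left_distrib[symmetric]) (auto simp: L2_set_def)
    \<comment> \<open>Since \<open>k > 1\<close> and \<open>Suc j \<le> r\<close>, the smallest
      weight is \<open>1 / k ^ r\<close>; this fixes the order of the final bound.\<close>
    also have "\<dots> \<le> L2_set (\<lambda>j. \<bar>d j / k ^ Suc j\<bar>) {..<r}"
    proof (rule L2_set_mono)
      fix j assume "j \<in> {..<r}"
      then have "k ^ Suc j \<le> k ^ r" using k1 by (intro power_increasing) auto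
      then have "\<bar>d j\<bar> / k ^ r \<le> \<bar>d j\<bar> / k ^ Suc j" using k1 by (intro divide_left_mono) auto
      then show "\<bar>d j\<bar> * (1 / k ^ r) \<le> \<bar>d j / k ^ Suc j\<bar>" using k1 by simp
    qed (use k1 in auto)
    also have "\<dots> = L2_set (\<lambda>j. d j / k ^ Suc j) {..<r}"
      by (simp only: L2_set_def power2_abs)
    finally have "c * (LH * \<delta> / k ^ r) \<le> c * L2_set (\<lambda>j. d j / k ^ Suc j) {..<r}"
      using c by (intro mult_left_mono) auto
    \<comment> \<open>The powers of \<open>k\<close> are put into the vector
      \<open>z j = d j / k ^ Suc j\<close>, which keeps \<open>c\<close> independent of
      \<open>k\<close>.\<close>
    also have "\<dots> \<le> L2_set (\<lambda>i. \<Sum>j<r. d j / k ^ Suc j / l i ^ Suc j) {..<r}" by (rule vdm)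
    also have "\<dots> = L2_set (\<lambda>i. Td i + (F q i - F p i)) {..<r}"
    proof (rule L2_set_cong[OF refl])
      fix i
      have "(\<Sum>j<r. d j / k ^ Suc j / l i ^ Suc j) = G k t1 q i - G k t1 p i"
        unfolding G_def d_def p_def q_def fst_conv snd_conv
        by (simp only: diff_divide_distrib sum_subtractf power_mult_distrib divide_divide_eq_left)
      then show "(\<Sum>j<r. d j / k ^ Suc j / l i ^ Suc j) = Td i + (F q i - F p i)"
        by (simp add: F_def Td_def p_def q_def)
    qed
    also have "\<dots> \<le> L2_set Td {..<r} + L2_set (\<lambda>i. F q i - F p i) {..<r}"
      by (rule L2_set_triangle_ineq)
    also have "L2_set (\<lambda>i. F q i - F p i) {..<r} \<le> (\<Sum>i<r. \<bar>F q i - F p i\<bar>)" by (rule L2_set_le_sum_abs)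
    also have "\<dots> \<le> (\<Sum>i<r. K i / k ^ Suc r * \<delta>)"
    proof (rule sum_mono)
      fix i assume "i \<in> {..<r}"
      then have i: "i < r" by simp
      have "blip (K i / k ^ Suc r) S (\<lambda>p. F p i)"
        unfolding F_def using w i t1 by (intro rem large[OF k]) (auto simp: filter_solution_def)
      then have "norm (F q i - F p i) \<le> K i / k ^ Suc r * norm (q - p)"
        using pq unfolding blip_def by blast
      also have "norm (q - p) = \<delta>" unfolding \<delta>_def by (subst norm_minus_commute) (simp add: p_def q_def)
      finally show "\<bar>F q i - F p i\<bar> \<le> K i / k ^ Suc r * \<delta>" by simp
    qed
    \<comment> \<open>The surplus factor \<open>1 / k\<close> of the remainder is split off; it
      makes the constant at most \<open>LT\<close>.\<close>
    also have "\<dots> = Ks / k * (\<delta> / k ^ r)"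
      by (simp add: Ks_def sum_distrib_right sum_divide_distrib)
    also have "\<dots> \<le> LT * (\<delta> / k ^ r)"
      using Kk[OF k] k1 by (intro mult_right_mono) (auto simp: \<delta>_def)
    finally have "c * (LH * \<delta> / k ^ r) \<le> L2_set Td {..<r} + LT * (\<delta> / k ^ r)" by simp
    moreover have "c * (LH * \<delta> / k ^ r) = 2 * (LT * (\<delta> / k ^ r))" by (simp add: LT_def)
    ultimately have "LT * (\<delta> / k ^ r) \<le> L2_set Td {..<r}" by linarith
    then show "LT / k ^ r * norm (x - x', \<theta> - \<theta>') \<le> L2_set (\<lambda>i. T A B C (\<lambda>i. k * l i) x \<theta> (w t1) i
        - T A B C (\<lambda>i. k * l i) x' \<theta>' (w t1) i) {..<r}"
      by (simp add: \<delta>_def Td_def[abs_def])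
  qed
qed

end
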